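(* Let $\mathcal Q=\langle Q,\Sigma,\Gamma,\$,s,\delta\rangle$ be a queue machine and let $G_t$ ($t\in Q$) be the global types associated with $\mathcal Q$ as described in the context. Then for every $\gamma\in\Sigma^\star$: $\mathcal Q$ does not accept $\gamma$ if and only if the type configuration $G_s\parallel\gamma\$$ is balanced.
   Context: A queue machine is a tuple $\mathcal Q=\langle Q,\Sigma,\Gamma,\$,s,\delta\rangle$ with $Q$ a finite set of states, $\Gamma$ a finite queue alphabet, $\Sigma\subseteq\Gamma$ the input alphabet, $\$\in\Gamma\setminus\Sigma$ the initial queue symbol, $s\in Q$ the initial state, and $\delta:Q\times\Gamma\to Q\times\Gamma^\star$ a total transition function. Configurations are pairs $\langle t,\alpha\rangle\in Q\times\Gamma^\star$, with transitions $\langle t,a\alpha\rangle\to\langle t',\alpha\beta\rangle$ whenever $\delta(t,a)=\langle t',\beta\rangle$. A word $\gamma\in\Sigma^\star$ is accepted if $\langle s,\gamma\$\rangle\to^\star\langle t,\epsilon\rangle$ for some $t\in Q$ ($\epsilon$ the empty word). Global types are possibly infinite regular terms $G ::= \mathsf{End}\mid \mathsf p\mathsf q!\{\lambda_i;G_i\}_{i\in I}\mid\mathsf p\mathsf q?\{\lambda_i;G_i\}_{i\in I}$ ($I$ finite nonempty, $\mathsf p\neq\mathsf q$ participants, $\lambda_i$ pairwise distinct labels); singleton output is written $\mathsf p\mathsf q!\lambda;G$. Messages are triples $\langle\mathsf p,\lambda,\mathsf q\rangle$ and queues are finite sequences of messages ($\emptyset$ empty, $\cdot$ concatenation). Take two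 fixed participants $\mathsf p\neq\mathsf q$ and labels the symbols of $\Gamma$; a word $\alpha\in\Gamma^\star$ is identified with the queue of messages $\langle\mathsf p,a,\mathsf q\rangle$ for the successive letters $a$ of $\alpha$. For every state $t\in Q$, $G_t$ is defined by the (mutually corecursive) equations $G_t=\mathsf p\mathsf q?\{a;\ \mathsf p\mathsf q!b^a_1;\ldots;\mathsf p\mathsf q!b^a_{n_a};G_{t'_a}\}_{a\in\Gamma}$, where $\delta(t,a)=\langle t'_a,b^a_1\cdots b^a_{n_a}\rangle$. Readability $\mathrm{read}(G,\mathcal M)$ (inductive): $\mathrm{read}(G,\emptyset)$; $\mathrm{read}(\mathsf p\mathsf q!\{\lambda_i;G_i\}_{i\in I},\mathcal M)$ if $\mathrm{read}(G_i,\mathcal M)$ $\forall i$; $\mathrm{read}(\mathsf p\mathsf q?\{\lambda_i;G_i\}_{i\in I},\langle\mathsf p,\lambda_h,\mathsf q\rangle\cdot\mathcal M)$ if $h\in I$ and $\mathrm{read}(G_i,\mathcal M)$ $\forall i$; $\mathrm{read}(\mathsf p\mathsf q?\{\lambda_i;G_i\}_{i\in I},\mathcal M)$ if $\mathcal M$ does not start (up to the reordering of messages with different sender/receiver pairs) with any $\langle\mathsf p,\lambda_i,\mathsf q\rangle$, and $\mathrm{read}(G_i,\mathcal M)$ $\forall i$. Balancing (coinductive): $\mathsf{End}\parallel\emptyset$ is balanced; $G=\mathsf p\mathsf q!\{\lambda_i;G_i\}_{i\in I}$ with $\mathcal M$ is balanced if $\mathrm{read}(G,\mathcal M)$ and each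 $G_i\parallel\mathcal M\cdot\langle\mathsf p,\lambda_i,\mathsf q\rangle$ is balanced; $G=\mathsf p\mathsf q?\{\lambda_i;G_i\}_{i\in I}$ with $\langle\mathsf p,\lambda_h,\mathsf q\rangle\cdot\mathcal M$, $h\in I$, is balanced if $\mathrm{read}(G,\langle\mathsf p,\lambda_h,\mathsf q\rangle\cdot\mathcal M)$ and $G_h\parallel\mathcal M$ is balanced. *)

theory Defs
  imports Main
begin

section \<open>Queue machines\<close>

record ('s, 'a) queue_machine =
  states :: "'s set"
  input_alphabet :: "'a set"
  queue_alphabet :: "'a set"
  initial_symbol :: 'a
  initial_state :: 's
  transition :: "'s \<Rightarrow> 'a \<Rightarrow> 's \<times> 'a list"

definition is_queue_machine :: "('s, 'a) queue_machine \<Rightarrow> bool" where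
  "is_queue_machine \<Q> \<longleftrightarrow>
     finite (states \<Q>) \<and>
     finite (queue_alphabet \<Q>) \<and>
     input_alphabet \<Q> \<subseteq> queue_alphabet \<Q> \<and>
     initial_symbol \<Q> \<in> queue_alphabet \<Q> - input_alphabet \<Q> \<and>
     initial_state \<Q> \<in> states \<Q> \<and>
     (\<forall>t \<in> states \<Q>. \<forall>a \<in> queue_alphabet \<Q>.
        transition \<Q> t a \<in> states \<Q> \<times> lists (queue_alphabet \<Q>))"

inductive qm_step ::
  "('s, 'a) queue_machine \<Rightarrow> 's \<times> 'a list \<Rightarrow> 's \<times> 'a list \<Rightarrow> bool"
  for \<Q> :: "('s, 'a) queue_machine" where
  "\<lbrakk>t \<in> states \<Q>; a \<in> queue_alphabet \<Q>; \<alpha> \<in> lists (queue_alphabet \<Q>);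
    transition \<Q> t a = (t', \<beta>)\<rbrakk>
   \<Longrightarrow> qm_step \<Q> (t, a # \<alpha>) (t', \<alpha> @ \<beta>)"

definition accepts :: "('s, 'a) queue_machine \<Rightarrow> 'a list \<Rightarrow> bool" where
  "accepts \<Q> \<gamma> \<longleftrightarrow>
     (\<exists>t \<in> states \<Q>.
        (qm_step \<Q>)\<^sup>*\<^sup>* (initial_state \<Q>, \<gamma> @ [initial_symbol \<Q>]) (t, []))"


section \<open>Global types\<close>

text \<open>
  A family of branches \<open>{\<lambda>\<^sub>i; G\<^sub>i}\<^sub>i\<close> is a partial map from labels to
  types, so that labels are pairwise distinct by construction.  The codatatype contains all
  (also non-regular) trees; the remaining syntactic conditions, namely distinct participants,
  finite nonempty branching and regularity, are collected in \<open>global_type\<close>.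
\<close>

codatatype ('p, 'l) gtype =
    End
  | Output 'p 'p "'l \<rightharpoonup> ('p, 'l) gtype"
  | Input 'p 'p "'l \<rightharpoonup> ('p, 'l) gtype"

inductive_set subterms :: "('p, 'l) gtype \<Rightarrow> ('p, 'l) gtype set"
  for G :: "('p, 'l) gtype" where
  subterms_self: "G \<in> subterms G"
| subterms_Output: "\<lbrakk>Output p q Gs \<in> subterms G; Gs l = Some H\<rbrakk> \<Longrightarrow> H \<in> subterms G"
| subterms_Input: "\<lbrakk>Input p q Gs \<in> subterms G; Gs l = Some H\<rbrakk> \<Longrightarrow> H \<in> subterms G"

definition global_type :: "('p, 'l) gtype \<Rightarrow> bool" where
  "global_type G \<longleftrightarrow>
     finite (subterms G) \<and>
     (\<forall>p q Gs. Output p q Gs \<in> subterms G \<or> Input p q Gs \<in> subterms G \<longrightarrow>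
        p \<noteq> q \<and> finite (dom Gs) \<and> dom Gs \<noteq> {})"


section \<open>Queues, readability and balancing\<close>

text \<open>A message \<open>(p, l, q)\<close> carries the label \<open>l\<close> from \<open>p\<close> to \<open>q\<close>.\<close>

type_synonym ('p, 'l) message = "'p \<times> 'l \<times> 'p"
type_synonym ('p, 'l) queue = "('p, 'l) message list"

inductive queue_swap :: "('p, 'l) queue \<Rightarrow> ('p, 'l) queue \<Rightarrow> bool" where
  "(p, q) \<noteq> (r, s) \<Longrightarrow>
     queue_swap (M\<^sub>1 @ (p, l, q) # (r, l', s) # M\<^sub>2) (M\<^sub>1 @ (r, l', s) # (p, l, q) # M\<^sub>2)"

text \<open>Since \<open>queue_swap\<close> is symmetric, this is an equivalence relation.\<close>

definition queue_equiv :: "('p, 'l) queue \<Rightarrow> ('p, 'l) queue \<Rightarrow> bool" (infix \<open>\<approx>\<close> 50) where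
  "queue_equiv = queue_swap\<^sup>*\<^sup>*"

text \<open>
  Queues are taken modulo \<open>\<approx>\<close>, hence a queue of the form
  \<open>\<langle>p, l, q\<rangle> \<cdot> M'\<close> is any \<open>M\<close> with \<open>M \<approx> (p, l, q) # M'\<close>.
\<close>

inductive readable :: "('p, 'l) gtype \<Rightarrow> ('p, 'l) queue \<Rightarrow> bool" where
  readable_Nil: "readable G []"
| readable_Output:
    "(\<And>l G. Gs l = Some G \<Longrightarrow> readable G M) \<Longrightarrow> readable (Output p q Gs) M"
| readable_Input:
    "\<lbrakk>M \<approx> (p, h, q) # M'; h \<in> dom Gs; \<And>l G. Gs l = Some G \<Longrightarrow> readable G M'\<rbrakk>
     \<Longrightarrow> readable (Input p q Gs) M"
| readable_Input_skip:
    "\<lbrakk>\<And>l M'. l \<in> dom Gs \<Longrightarrow> \<not> M \<approx> (p, l, q) # M';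
      \<And>l G. Gs l = Some G \<Longrightarrow> readable G M\<rbrakk>
     \<Longrightarrow> readable (Input p q Gs) M"

coinductive balanced :: "('p, 'l) gtype \<Rightarrow> ('p, 'l) queue \<Rightarrow> bool" where
  balanced_End: "balanced End []"
| balanced_Output:
    "\<lbrakk>readable (Output p q Gs) M;
      \<And>l G. Gs l = Some G \<Longrightarrow> balanced G (M @ [(p, l, q)])\<rbrakk>
     \<Longrightarrow> balanced (Output p q Gs) M"
| balanced_Input:
    "\<lbrakk>M \<approx> (p, h, q) # M'; Gs h = Some G; readable (Input p q Gs) M; balanced G M'\<rbrakk>
     \<Longrightarrow> balanced (Input p q Gs) M"


section \<open>The global types of a queue machine\<close>

definition word_queue :: "'p \<Rightarrow> 'p \<Rightarrow> 'a list \<Rightarrow> ('p, 'a) queue" where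
  "word_queue p q \<alpha> = map (\<lambda>a. (p, a, q)) \<alpha>"

text \<open>
  \<open>qm_gtype_out \<Q> p q \<beta> t\<close> outputs the letters of \<open>\<beta>\<close> one by one and then
  behaves as the type of the state \<open>t\<close>.  The defining equations of the types of the states
  are \<open>qm_gtype_eq\<close> below.
\<close>

primcorec qm_gtype_out ::
  "('s, 'a) queue_machine \<Rightarrow> 'p \<Rightarrow> 'p \<Rightarrow> 'a list \<Rightarrow> 's \<Rightarrow> ('p, 'a) gtype" where
  "qm_gtype_out \<Q> p q \<beta> t =
     (case \<beta> of
        [] \<Rightarrow> Input p q (\<lambda>a.
                if a \<in> queue_alphabet \<Q>
                then Some (qm_gtype_out \<Q> p q (snd (transition \<Q> t a)) (fst (transition \<Q> t a)))
                else None)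
      | b # \<beta>' \<Rightarrow> Output p q (\<lambda>l. if l = b then Some (qm_gtype_out \<Q> p q \<beta>' t) else None))"

definition qm_gtype ::
  "('s, 'a) queue_machine \<Rightarrow> 'p \<Rightarrow> 'p \<Rightarrow> 's \<Rightarrow> ('p, 'a) gtype" where
  "qm_gtype \<Q> p q t = qm_gtype_out \<Q> p q [] t"

definition outputs :: "'p \<Rightarrow> 'p \<Rightarrow> 'a list \<Rightarrow> ('p, 'a) gtype \<Rightarrow> ('p, 'a) gtype" where
  "outputs p q \<beta> G = foldr (\<lambda>b H. Output p q [b \<mapsto> H]) \<beta> G"

lemma qm_gtype_out_Nil:
  "qm_gtype_out \<Q> p q [] t = Input p q (\<lambda>a.
     if a \<in> queue_alphabet \<Q>
     then Some (qm_gtype_out \<Q> p q (snd (transition \<Q> t a)) (fst (transition \<Q> t a))) else None)"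
  by (subst qm_gtype_out.code) simp

lemma qm_gtype_out_Cons:
  "qm_gtype_out \<Q> p q (b # \<beta>) t = Output p q [b \<mapsto> qm_gtype_out \<Q> p q \<beta> t]"
  by (subst qm_gtype_out.code) (auto simp: fun_eq_iff)

lemma qm_gtype_out_eq: "qm_gtype_out \<Q> p q \<beta> t = outputs p q \<beta> (qm_gtype \<Q> p q t)"
  by (induction \<beta>) (simp_all add: outputs_def qm_gtype_def qm_gtype_out_Cons)

theorem qm_gtype_eq:
  "qm_gtype \<Q> p q t = Input p q (\<lambda>a.
     if a \<in> queue_alphabet \<Q>
     then (case transition \<Q> t a of (t', \<beta>) \<Rightarrow> Some (outputs p q \<beta> (qm_gtype \<Q> p q t')))
     else None)"
  unfolding qm_gtype_def[of \<Q> p q t] qm_gtype_out_Nil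
  by (auto simp: fun_eq_iff qm_gtype_out_eq split: prod.split)

theorem global_type_qm_gtype:
  assumes wf: "is_queue_machine \<Q>" and "p \<noteq> q" and t: "t \<in> states \<Q>"
  shows "global_type (qm_gtype \<Q> p q t)"
proof -
  define W where "W = insert [] (\<Union>t \<in> states \<Q>. \<Union>a \<in> queue_alphabet \<Q>.
    (\<lambda>n. drop n (snd (transition \<Q> t a))) ` {..length (snd (transition \<Q> t a))})"
  define S where "S = (\<lambda>(\<beta>, t). qm_gtype_out \<Q> p q \<beta> t) ` (W \<times> states \<Q>)"
  have fin: "finite (states \<Q>)" "finite (queue_alphabet \<Q>)" "queue_alphabet \<Q> \<noteq> {}"
    using wf by (auto simp: is_queue_machine_def)
  have "finite S"
    using fin by (auto simp: S_def W_def)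
  have W_trans: "snd (transition \<Q> u a) \<in> W" if "u \<in> states \<Q>" "a \<in> queue_alphabet \<Q>" for u a
    proof -
    have "snd (transition \<Q> u a) \<in> (\<lambda>n. drop n (snd (transition \<Q> u a))) ` {..length (snd (transition \<Q> u a))}"
      by (rule image_eqI[where x = 0]) auto
    then show ?thesis
      using that unfolding W_def by blast
  qed
  have W_tl: "\<beta> \<in> W" if "b # \<beta> \<in> W" for b \<beta>
  proof -
    from that obtain u a n where *: "u \<in> states \<Q>" "a \<in> queue_alphabet \<Q>"
      "n \<le> length (snd (transition \<Q> u a))" "b # \<beta> = drop n (snd (transition \<Q> u a))"
      by (auto simp: W_def)
    have "\<beta> = drop (Suc n) (snd (transition \<Q> u a))"
      using *(4) by (metis drop_Suc list.sel(3) tl_drop)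
    moreover have "Suc n \<le> length (snd (transition \<Q> u a))"
      using *(4) by (metis Suc_leI drop_eq_Nil2 linorder_not_le list.distinct(1))
    ultimately show ?thesis
      using * unfolding W_def by blast
  qed
  have S_cases: "(\<exists>Gs. (H = Output p q Gs \<or> H = Input p q Gs) \<and>
      finite (dom Gs) \<and> dom Gs \<noteq> {} \<and> ran Gs \<subseteq> S)" if H: "H \<in> S" for H
  proof -
    from H obtain \<beta> u where H_eq: "H = qm_gtype_out \<Q> p q \<beta> u" and \<beta>: "\<beta> \<in> W"
      and u: "u \<in> states \<Q>"
      by (auto simp: S_def)
    show ?thesis
    proof (cases \<beta>)
      case Nil
      have "fst (transition \<Q> u a) \<in> states \<Q>" if "a \<in> queue_alphabet \<Q>" for a
        using wf u that by (auto simp: is_queue_machine_def mem_Times_iff)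
      then have "qm_gtype_out \<Q> p q (snd (transition \<Q> u a)) (fst (transition \<Q> u a)) \<in> S"
        if "a \<in> queue_alphabet \<Q>" for a
        using that W_trans[OF u that] unfolding S_def by force
      then show ?thesis
        using fin unfolding H_eq Nil qm_gtype_out_Nil
        by (auto simp: dom_def ran_def)
    next
      case (Cons b \<beta>')
      then have "qm_gtype_out \<Q> p q \<beta>' u \<in> S"
        using W_tl \<beta> u by (force simp: S_def)
      then show ?thesis
        unfolding H_eq Cons qm_gtype_out_Cons by auto
    qed
  qed
  have base: "qm_gtype \<Q> p q t \<in> S"
    using t by (force simp: S_def W_def qm_gtype_def)
  have sub: "H \<in> S" if "H \<in> subterms (qm_gtype \<Q> p q t)" for H
    using that
  proof (induction rule: subterms.induct)
    case subterms_self
    show ?case by (rule base)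
  next
    case (subterms_Output p' q' Gs l H)
    then show ?case
      using S_cases[of "Output p' q' Gs"] by (auto intro: ranI)
  next
    case (subterms_Input p' q' Gs l H)
    then show ?case
      using S_cases[of "Input p' q' Gs"] by (auto intro: ranI)
  qed
  have "p' \<noteq> q' \<and> finite (dom Gs) \<and> dom Gs \<noteq> {}"
    if "Output p' q' Gs \<in> subterms (qm_gtype \<Q> p q t) \<or>
      Input p' q' Gs \<in> subterms (qm_gtype \<Q> p q t)" for p' q' Gs
    using that
  proof
    assume "Output p' q' Gs \<in> subterms (qm_gtype \<Q> p q t)"
    from S_cases[OF sub[OF this]] show ?thesis
      using \<open>p \<noteq> q\<close> by auto
  next
    assume "Input p' q' Gs \<in> subterms (qm_gtype \<Q> p q t)"
    from S_cases[OF sub[OF this]] show ?thesis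
      using \<open>p \<noteq> q\<close> by auto
  qed
  moreover have "finite (subterms (qm_gtype \<Q> p q t))"
    using sub \<open>finite S\<close> by (meson finite_subset subsetI)
  ultimately show ?thesis
    unfolding global_type_def by blast
qed

end

(* In a queue of messages sharing sender and receiver nothing can be reordered, so a word over
   the queue alphabet is readable by every G_t, and the configurations G_t || alpha simulate the
   machine step by step: reading a letter and performing the outputs that follow is one transition.
   The only obstruction to balancing is G_t facing the empty queue, that is, acceptance. *)
theory Submission
  imports Defs
begin

lemma word_queue_simps [simp]:
  "word_queue p q [] = []"
  "word_queue p q (a # \<alpha>) = (p, a, q) # word_queue p q \<alpha>"
  "word_queue p q (\<alpha> @ \<beta>) = word_queue p q \<alpha> @ word_queue p q \<beta>"
  by (simp_all add: word_queue_def)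

text \<open>A swap exchanges neighbours with different sender/receiver pairs, whereas every message
  here carries the same pair \<open>(p, q)\<close>.\<close>

lemma queue_swap_word_queue: "\<not> queue_swap (word_queue p q \<alpha>) N"
proof
  assume "queue_swap (word_queue p q \<alpha>) N"
  then obtain p' q' r s l l' M1 M2 where neq: "(p', q') \<noteq> (r, s)"
    and eq: "word_queue p q \<alpha> = M1 @ (p', l, q') # (r, l', s) # M2"
    by cases blast
  have "{(p', l, q'), (r, l', s)} \<subseteq> set (word_queue p q \<alpha>)"
    unfolding eq by simp
  with neq show False
    by (auto simp: word_queue_def)
qed

lemma queue_equiv_word_queue: "word_queue p q \<alpha> \<approx> N \<longleftrightarrow> N = word_queue p q \<alpha>"
  unfolding queue_equiv_def
  by (metis converse_rtranclpE queue_swap_word_queue rtranclp.rtrancl_refl)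

text \<open>An input on a nonempty word removes its first letter, whichever branch follows, and an
  output leaves the queue to be read unchanged. Hence an outer induction on the word, for all
  pending outputs and states at once, and an inner one on the pending outputs.\<close>

lemma readable_qm_gtype_out:
  assumes "\<alpha> \<in> lists (queue_alphabet \<Q>)"
  shows "readable (qm_gtype_out \<Q> p q \<beta> t) (word_queue p q \<alpha>)"
  using assms
proof (induction \<alpha> arbitrary: \<beta> t)
  case Nil
  show ?case by (simp add: readable_Nil)
next
  case (Cons a \<alpha>)
  show ?case
  proof (induction \<beta>)
    case Nil
    show ?case
      unfolding qm_gtype_out_Nil
      by (rule readable_Input[where h = a and M' = "word_queue p q \<alpha>"])
        (use Cons in \<open>auto simp: queue_equiv_def split: if_splits\<close>)
  next
    case (Cons b \<beta>)
    then show ?case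
      unfolding qm_gtype_out_Cons by (auto intro: readable_Output split: if_splits)
  qed
qed

text \<open>Each output is forced and moves the first pending letter to the end of the queue, so the
  queue varies in the induction.\<close>

lemma balanced_outputs:
  "balanced (qm_gtype_out \<Q> p q \<beta> t) (word_queue p q \<alpha>) \<Longrightarrow>
   balanced (qm_gtype_out \<Q> p q [] t) (word_queue p q (\<alpha> @ \<beta>))"
proof (induction \<beta> arbitrary: \<alpha>)
  case (Cons b \<beta>)
  from Cons.prems have "balanced (qm_gtype_out \<Q> p q \<beta> t) (word_queue p q (\<alpha> @ [b]))"
    unfolding qm_gtype_out_Cons by (cases rule: balanced.cases) auto
  from Cons.IH[OF this] show ?case by simp
qed simp

text \<open>The queue is equivalent only to itself, so the input must consume exactly the letter
  \<open>a\<close> that the machine reads; performing the outputs that follow then appends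
  \<open>\<beta>\<close>.\<close>

lemma balanced_qm_step:
  assumes "qm_step \<Q> (t, \<alpha>) (t', \<alpha>')"
    and "balanced (qm_gtype_out \<Q> p q [] t) (word_queue p q \<alpha>)"
  shows "balanced (qm_gtype_out \<Q> p q [] t') (word_queue p q \<alpha>')"
  using assms(1)
proof cases
  case (1 a \<alpha>0 \<beta>)
  from assms(2) have "balanced (qm_gtype_out \<Q> p q \<beta> t') (word_queue p q \<alpha>0)"
    unfolding qm_gtype_out_Nil \<open>\<alpha> = a # \<alpha>0\<close>
    by (cases rule: balanced.cases)
      (use 1 in \<open>auto simp: queue_equiv_word_queue simp flip: word_queue_simps(2) split: if_splits\<close>,
       auto)
  from balanced_outputs[OF this] show ?thesis
    using 1 by simp
qed

lemma balanced_qm_steps: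
  assumes "(qm_step \<Q>)\<^sup>*\<^sup>* (t, \<alpha>) (t', \<alpha>')"
    and "balanced (qm_gtype_out \<Q> p q [] t) (word_queue p q \<alpha>)"
  shows "balanced (qm_gtype_out \<Q> p q [] t') (word_queue p q \<alpha>')"
  using assms by (induction rule: rtranclp_induct2) (blast intro: balanced_qm_step)+

text \<open>An input needs a first message, and no nonempty queue is equivalent to the empty
  one.\<close>

lemma not_balanced_qm_gtype_out_Nil: "\<not> balanced (qm_gtype_out \<Q> p q [] t) []"
proof
  assume "balanced (qm_gtype_out \<Q> p q [] t) []"
  then show False
    unfolding qm_gtype_out_Nil
    by (cases rule: balanced.cases) (use queue_equiv_word_queue[of _ _ "[]"] in auto)
qed

lemma balanced_qm_gtype_out:
  assumes wf: "is_queue_machine \<Q>"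
    and "t \<in> states \<Q>" "\<alpha> \<in> lists (queue_alphabet \<Q>)" "\<beta> \<in> lists (queue_alphabet \<Q>)"
    and "\<not> (\<exists>u \<in> states \<Q>. (qm_step \<Q>)\<^sup>*\<^sup>* (t, \<alpha> @ \<beta>) (u, []))"
  shows "balanced (qm_gtype_out \<Q> p q \<beta> t) (word_queue p q \<alpha>)"
proof -
  \<comment> \<open>Balancing also visits types in the middle of their outputs. Letters still to be
    output count as already queued, so such a pair stands for the machine configuration
    \<open>(t, \<alpha> @ \<beta>)\<close>.\<close>
  define R where "R G M \<longleftrightarrow> (\<exists>t \<alpha> \<beta>. G = qm_gtype_out \<Q> p q \<beta> t \<and> M = word_queue p q \<alpha> \<and>
    t \<in> states \<Q> \<and> \<alpha> \<in> lists (queue_alphabet \<Q>) \<and> \<beta> \<in> lists (queue_alphabet \<Q>) \<and>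
    \<not> (\<exists>u \<in> states \<Q>. (qm_step \<Q>)\<^sup>*\<^sup>* (t, \<alpha> @ \<beta>) (u, [])))" for G M
  have "R (qm_gtype_out \<Q> p q \<beta> t) (word_queue p q \<alpha>)"
    using assms unfolding R_def by blast
  then show ?thesis
  proof (coinduct rule: balanced.coinduct)
    case (balanced G M)
    then obtain t \<alpha> \<beta> where G: "G = qm_gtype_out \<Q> p q \<beta> t" and M: "M = word_queue p q \<alpha>"
      and t: "t \<in> states \<Q>" and \<alpha>: "\<alpha> \<in> lists (queue_alphabet \<Q>)"
      and \<beta>: "\<beta> \<in> lists (queue_alphabet \<Q>)"
      and nacc: "\<not> (\<exists>u \<in> states \<Q>. (qm_step \<Q>)\<^sup>*\<^sup>* (t, \<alpha> @ \<beta>) (u, []))"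
      unfolding R_def by blast
    have read: "readable G M"
      unfolding G M using \<alpha> by (rule readable_qm_gtype_out)
    show ?case
    proof (cases \<beta>)
      case Nil
      \<comment> \<open>With both words empty, the machine would accept in zero steps.\<close>
      with nacc t obtain a \<alpha>' where \<alpha>_eq: "\<alpha> = a # \<alpha>'"
        by (cases \<alpha>) auto
      with \<alpha> have a: "a \<in> queue_alphabet \<Q>" and \<alpha>': "\<alpha>' \<in> lists (queue_alphabet \<Q>)"
        by auto
      obtain t' \<beta>' where tr: "transition \<Q> t a = (t', \<beta>')"
        by fastforce
      with wf t a have t': "t' \<in> states \<Q>" and \<beta>': "\<beta>' \<in> lists (queue_alphabet \<Q>)"
        by (fastforce simp: is_queue_machine_def)+
      have "qm_step \<Q> (t, \<alpha> @ \<beta>) (t', \<alpha>' @ \<beta>')"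
        using qm_step.intros[OF t a \<alpha>' tr] by (simp add: \<alpha>_eq Nil)
      with nacc have "R (qm_gtype_out \<Q> p q \<beta>' t') (word_queue p q \<alpha>')"
        using t' \<alpha>' \<beta>' unfolding R_def by (blast intro: converse_rtranclp_into_rtranclp)
      moreover have "M \<approx> (p, a, q) # word_queue p q \<alpha>'"
        by (simp add: M \<alpha>_eq queue_equiv_def)
      ultimately show ?thesis
        using read a tr unfolding G Nil qm_gtype_out_Nil by fastforce
    next
      case (Cons b \<beta>')
      \<comment> \<open>The letter \<open>b\<close> passes from the pending outputs to the queue, so
        the machine configuration represented stays the same.\<close>
      have "R (qm_gtype_out \<Q> p q \<beta>' t) (word_queue p q (\<alpha> @ [b]))"
        unfolding R_def using t \<alpha> \<beta> nacc
        by (intro exI[of _ t] exI[of _ "\<alpha> @ [b]"] exI[of _ \<beta>']) (simp add: Cons)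
      then show ?thesis
        using read unfolding G M Cons qm_gtype_out_Cons by auto
    qed
  qed
qed

theorem theorem5p3:
  fixes \<Q> :: "('s, 'a) queue_machine"
    and p q :: 'p
    and \<gamma> :: "'a list"
  assumes "is_queue_machine \<Q>"
    and "p \<noteq> q"
    and "\<gamma> \<in> lists (input_alphabet \<Q>)"
  shows "\<not> accepts \<Q> \<gamma> \<longleftrightarrow>
    balanced (qm_gtype \<Q> p q (initial_state \<Q>))
      (word_queue p q (\<gamma> @ [initial_symbol \<Q>]))"
proof
  assume "\<not> accepts \<Q> \<gamma>"
  moreover have "\<gamma> @ [initial_symbol \<Q>] \<in> lists (queue_alphabet \<Q>)"
    "initial_state \<Q> \<in> states \<Q>"
    using assms by (auto simp: is_queue_machine_def)
  ultimately show "balanced (qm_gtype \<Q> p q (initial_state \<Q>))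
      (word_queue p q (\<gamma> @ [initial_symbol \<Q>]))"
    unfolding qm_gtype_def accepts_def
    by (intro balanced_qm_gtype_out[OF assms(1)]) simp_all
next
  assume "balanced (qm_gtype \<Q> p q (initial_state \<Q>))
      (word_queue p q (\<gamma> @ [initial_symbol \<Q>]))"
  then show "\<not> accepts \<Q> \<gamma>"
    unfolding qm_gtype_def accepts_def
    \<comment> \<open>An accepting run would carry balancing along to an input type facing the empty
      queue.\<close>
    by (metis balanced_qm_steps not_balanced_qm_gtype_out_Nil word_queue_simps(1))
qed

end
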